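(* Let $G$ be an $N$-player partizan game. Then $G\le_L 0$ if and only if Left does not have a winning strategy in $G$ when Left moves first.
   Context: An $N$-player partizan game ($N\ge2$) is an ordered $N$-tuple $(\mathscr G^{C_0},\dots,\mathscr G^{C_{N-1}})$ of finite sets of partizan games (no infinite runs); players Left $=C_0$, $C_1,\dots,C_{N-2}$, Right $=C_{N-1}$ move cyclically (Left after Right), $\mathscr G^{C_i}$ being the options for $C_i$. Under normal play, a player with no option on their turn is the unique loser and all others win. $0$ is the game with no options. The disjunctive sum $G+H$ has $C_i$-options $G^{C_i}+H$ and $G+H^{C_i}$. "Left has a winning strategy in $G$ moving $i$th" ($1\le i\le N$) means that when play starts with the player for whom Left is $i$th to move, Left can guarantee not being the loser. $G\le_L H$ means: for every game $X$ and every $1\le i\le N$, if Left has a winning strategy in $G+X$ moving $i$th then Left has a winning strategy in $H+X$ moving $i$th. *)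

theory Defs
  imports "HOL-Library.FSet"
begin

(* Being an inductive datatype, "game" contains no infinite runs.  The number of players is
   the length of the tuple, which "partizan N" requires to be N in every subposition.
   Player C_i is the number i < N: Left is 0 and Right is N - 1. *)
datatype game = Game (tuple: "game fset list")

inductive partizan :: "nat \<Rightarrow> game \<Rightarrow> bool" for N :: nat where
  "length Gs = N \<Longrightarrow> (\<And>A g. A \<in> set Gs \<Longrightarrow> g |\<in>| A \<Longrightarrow> partizan N g) \<Longrightarrow> partizan N (Game Gs)"

definition opts :: "game \<Rightarrow> nat \<Rightarrow> game fset" where
  "opts G i = (if i < length (tuple G) then tuple G ! i else {||})"

definition zero_game :: "nat \<Rightarrow> game" where
  "zero_game N = Game (replicate N {||})"

lemma option_size_less: "g |\<in>| opts G i \<Longrightarrow> size g < size G"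
proof (cases G)
  case (Game Gs)
  assume g: "g |\<in>| opts G i"
  with Game have i: "i < length Gs" and gi: "g |\<in>| Gs ! i"
    by (auto simp: opts_def split: if_splits)
  have "size g < Suc (size g)" by simp
  also have "\<dots> \<le> (\<Sum>x\<in>fset (Gs ! i). Suc (size x))"
    using gi by (intro member_le_sum[of g _ "\<lambda>x. Suc (size x)"]) auto
  also have "\<dots> = size_fset size (Gs ! i)"
    by (simp add: size_fset_simps)
  also have "\<dots> \<le> size_list (size_fset size) Gs"
    using i by (intro size_list_estimation'[OF nth_mem]) auto
  finally show ?thesis unfolding Game game.size by simp
qed

function disj_sum :: "game \<Rightarrow> game \<Rightarrow> game" (infixl \<open>\<oplus>\<close> 65) where
  "G \<oplus> H = Game (map (\<lambda>i. (\<lambda>G'. G' \<oplus> H) |`| opts G i |\<union>| (\<lambda>H'. G \<oplus> H') |`| opts H i)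
                       [0..<length (tuple G)])"
  by pat_completeness auto
termination
  by (relation "measure (\<lambda>(G, H). size G + size H)") (auto dest: option_size_less)

declare disj_sum.simps [simp del]

lemma opts_disj_sum:
  assumes "length (tuple G) = N" "length (tuple H) = N"
  shows "opts (G \<oplus> H) i = (\<lambda>G'. G' \<oplus> H) |`| opts G i |\<union>| (\<lambda>H'. G \<oplus> H') |`| opts H i"
  using assms by (subst disj_sum.simps) (auto simp: opts_def)

(* A history lists the positions of a play, most recent first; s is the starting player. *)
definition to_move :: "nat \<Rightarrow> nat \<Rightarrow> game list \<Rightarrow> nat" where
  "to_move N s h = (s + (length h - 1)) mod N"

definition left_strategy :: "(game list \<Rightarrow> game) \<Rightarrow> bool" where
  "left_strategy \<sigma> \<longleftrightarrow>
     (\<forall>h. h \<noteq> [] \<longrightarrow> opts (hd h) 0 \<noteq> {||} \<longrightarrow> \<sigma> h |\<in>| opts (hd h) 0)"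

inductive play :: "nat \<Rightarrow> nat \<Rightarrow> game \<Rightarrow> (game list \<Rightarrow> game) \<Rightarrow> game list \<Rightarrow> bool"
  for N :: nat and s :: nat and G :: game and \<sigma> :: "game list \<Rightarrow> game" where
  start: "play N s G \<sigma> [G]"
| move: "play N s G \<sigma> h \<Longrightarrow> g |\<in>| opts (hd h) (to_move N s h) \<Longrightarrow>
         (to_move N s h = 0 \<Longrightarrow> g = \<sigma> h) \<Longrightarrow> play N s G \<sigma> (g # h)"

definition is_loser :: "nat \<Rightarrow> nat \<Rightarrow> game list \<Rightarrow> nat \<Rightarrow> bool" where
  "is_loser N s h p \<longleftrightarrow> to_move N s h = p \<and> opts (hd h) p = {||}"

definition left_wins_from :: "nat \<Rightarrow> nat \<Rightarrow> game \<Rightarrow> bool" where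
  "left_wins_from N s G \<longleftrightarrow>
     (\<exists>\<sigma>. left_strategy \<sigma> \<and> (\<forall>h. play N s G \<sigma> h \<longrightarrow> \<not> is_loser N s h 0))"

(* Left is i-th to move exactly when the starting player s satisfies s + (i - 1) = 0 mod N. *)
definition left_wins_moving :: "nat \<Rightarrow> nat \<Rightarrow> game \<Rightarrow> bool" where
  "left_wins_moving N i G \<longleftrightarrow> left_wins_from N ((N + 1 - i) mod N) G"

definition le_left :: "nat \<Rightarrow> game \<Rightarrow> game \<Rightarrow> bool" where
  "le_left N G H \<longleftrightarrow>
     (\<forall>X i. partizan N X \<longrightarrow> 1 \<le> i \<longrightarrow> i \<le> N \<longrightarrow>
        left_wins_moving N i (G \<oplus> X) \<longrightarrow> left_wins_moving N i (H \<oplus> X))"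

end

(* Left plays against the coalition of all other players.  If the coalition beats Left in G with
   Left to move, then it can add G to any X that it is winning: it keeps to its strategy in X, and
   whenever Left moves in one component, all the other players answer in that component until Left
   is to move again. *)
theory Submission
  imports Defs
begin

text \<open>Backward induction on positions, with player \<open>p\<close> to move, so that histories
  and strategies drop out of the later arguments. The base case is \<open>other\<close> without
  options: a stuck opponent is the loser, so Left wins.\<close>

inductive wins_to_move :: "nat \<Rightarrow> nat \<Rightarrow> game \<Rightarrow> bool" for N :: nat where
  left: "g |\<in>| opts G 0 \<Longrightarrow> wins_to_move N (Suc 0 mod N) g \<Longrightarrow> wins_to_move N 0 G"
| other: "p \<noteq> 0 \<Longrightarrow> (\<And>g. g |\<in>| opts G p \<Longrightarrow> wins_to_move N (Suc p mod N) g)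
    \<Longrightarrow> wins_to_move N p G"

(* Rewriting Suc 0 mod N to a case distinction on N = 1 makes wins_to_move_0_iff loop. *)
declare Suc_0_mod_eq [simp del]

lemma wins_to_move_0_iff:
  "wins_to_move N 0 G \<longleftrightarrow> (\<exists>g. g |\<in>| opts G 0 \<and> wins_to_move N (Suc 0 mod N) g)"
  by (subst wins_to_move.simps) auto

lemma wins_to_move_other_iff:
  "p \<noteq> 0 \<Longrightarrow>
    wins_to_move N p G \<longleftrightarrow> (\<forall>g. g |\<in>| opts G p \<longrightarrow> wins_to_move N (Suc p mod N) g)"
  by (subst wins_to_move.simps) auto

lemma play_not_Nil: "play N s G \<sigma> h \<Longrightarrow> h \<noteq> []"
  by (induction rule: play.induct) auto

text \<open>The number of moves made is \<open>length h - 1\<close>; truncated subtraction would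
  count \<open>[]\<close> like a single position, hence \<open>h\<close> must be nonempty.\<close>

lemma to_move_Cons: "h \<noteq> [] \<Longrightarrow> to_move N s (g # h) = Suc (to_move N s h) mod N"
  by (cases h) (auto simp: to_move_def mod_Suc_eq)

text \<open>Since \<open>\<sigma>\<close> may depend on the whole history, the claim is made for
  every play consistent with \<open>\<sigma>\<close>, not just for the start. Each move shrinks the
  current position, which gives the induction.\<close>

lemma wins_to_move_if_strategy_wins:
  assumes \<sigma>: "left_strategy \<sigma>" and safe: "\<And>h. play N s G \<sigma> h \<Longrightarrow> \<not> is_loser N s h 0"
    and "play N s G \<sigma> h"
  shows "wins_to_move N (to_move N s h) (hd h)"
  using assms(3)
proof (induction "size (hd h)" arbitrary: h rule: less_induct)
  case less
  note h = play_not_Nil[OF less.prems]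
  show ?case
  proof (cases "to_move N s h = 0")
    case True
    then have "opts (hd h) 0 \<noteq> {||}"
      using safe[OF less.prems] by (auto simp: is_loser_def)
    then have g: "\<sigma> h |\<in>| opts (hd h) 0"
      using \<sigma> h by (auto simp: left_strategy_def)
    then have "play N s G \<sigma> (\<sigma> h # h)"
      using True by (intro play.move less.prems) auto
    then have "wins_to_move N (to_move N s (\<sigma> h # h)) (\<sigma> h)"
      using less.hyps[of "\<sigma> h # h"] option_size_less[OF g] by simp
    then show ?thesis
      using g True h by (auto simp: wins_to_move_0_iff to_move_Cons)
  next
    case False
    have "wins_to_move N (Suc (to_move N s h) mod N) g"
      if g: "g |\<in>| opts (hd h) (to_move N s h)" for g
    proof -
      have "play N s G \<sigma> (g # h)"
        using False g by (intro play.move less.prems) auto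
      then show ?thesis
        using less.hyps[of "g # h"] option_size_less[OF g] h by (simp add: to_move_Cons)
    qed
    then show ?thesis
      using False by (simp add: wins_to_move_other_iff)
  qed
qed

text \<open>A positional strategy suffices: Left always moves to a position that is still won. This
  keeps \<open>wins_to_move\<close> invariant along the play, and where it holds Left is never
  stuck.\<close>

lemma strategy_wins_if_wins_to_move:
  assumes "wins_to_move N (s mod N) G"
  shows "left_wins_from N s G"
proof -
  define good where "good G g \<longleftrightarrow> g |\<in>| opts G 0 \<and> wins_to_move N (Suc 0 mod N) g" for G g
  have good_opt: "good G g \<Longrightarrow> g |\<in>| opts G 0" for G g
    by (simp add: good_def)
  \<comment> \<open>The second choice is a fallback for lost positions: \<open>left_strategy\<close>
    demands a legal move after every nonempty history where Left has one.\<close>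
  define \<sigma> where
    "\<sigma> h = (if \<exists>g. good (hd h) g then SOME g. good (hd h) g else SOME g. g |\<in>| opts (hd h) 0)"
    for h
  have good: "good (hd h) (\<sigma> h)" if "wins_to_move N 0 (hd h)" for h
  proof -
    have "\<exists>g. good (hd h) g"
      using that by (simp add: wins_to_move_0_iff good_def)
    then show ?thesis
      using someI_ex[of "good (hd h)"] by (simp add: \<sigma>_def)
  qed
  have strategy: "left_strategy \<sigma>"
    unfolding left_strategy_def
  proof (intro allI impI)
    fix h :: "game list"
    assume "opts (hd h) 0 \<noteq> {||}"
    then have "\<exists>g. g |\<in>| opts (hd h) 0" by auto
    from someI_ex[OF this] show "\<sigma> h |\<in>| opts (hd h) 0"
      using someI_ex[of "good (hd h)"] by (auto simp: \<sigma>_def dest: good_opt)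
  qed
  have inv: "wins_to_move N (to_move N s h) (hd h)" if "play N s G \<sigma> h" for h
    using that
  proof (induction rule: play.induct)
    case start
    then show ?case using assms by (simp add: to_move_def)
  next
    case (move h g)
    note h = play_not_Nil[OF move.hyps(1)]
    show ?case
    proof (cases "to_move N s h = 0")
      case True
      then show ?thesis
        using good[of h] move h by (simp add: to_move_Cons good_def)
    next
      case False
      then show ?thesis
        using move h by (simp add: to_move_Cons wins_to_move_other_iff)
    qed
  qed
  have "\<not> is_loser N s h 0" if "play N s G \<sigma> h" for h
    using inv[OF that] by (auto simp: is_loser_def wins_to_move_0_iff)
  with strategy show ?thesis
    unfolding left_wins_from_def by blast
qed

lemma left_wins_from_iff: "left_wins_from N s G \<longleftrightarrow> wins_to_move N (s mod N) G"
proof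
  assume "left_wins_from N s G"
  then obtain \<sigma> where "left_strategy \<sigma>" "\<And>h. play N s G \<sigma> h \<Longrightarrow> \<not> is_loser N s h 0"
    unfolding left_wins_from_def by blast
  \<comment> \<open>The play consisting of \<open>G\<close> alone has \<open>s mod N\<close> to
    move.\<close>
  from wins_to_move_if_strategy_wins[OF this play.start]
  show "wins_to_move N (s mod N) G" by (simp add: to_move_def)
qed (rule strategy_wins_if_wins_to_move)

lemma left_wins_moving_iff:
  "left_wins_moving N i G \<longleftrightarrow> wins_to_move N ((N + 1 - i) mod N) G"
  by (simp add: left_wins_moving_def left_wins_from_iff)

lemma partizan_length: "partizan N G \<Longrightarrow> length (tuple G) = N"
  by (auto elim: partizan.cases)

lemma partizan_opts: "partizan N G \<Longrightarrow> g |\<in>| opts G i \<Longrightarrow> partizan N g"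
  by (erule partizan.cases) (auto simp: opts_def dest: nth_mem split: if_splits)

lemma partizan_zero_game: "partizan N (zero_game N)"
  by (auto simp: zero_game_def intro: partizan.intros)

lemma opts_zero_game [simp]: "opts (zero_game N) i = {||}"
  by (simp add: opts_def zero_game_def)

lemma game_eqI:
  assumes "length (tuple G) = N" "length (tuple H) = N" "\<And>i. i < N \<Longrightarrow> opts G i = opts H i"
  shows "G = H"
proof -
  have "tuple G = tuple H"
    using assms by (intro nth_equalityI) (auto simp: opts_def)
  then show ?thesis by (simp add: game.expand)
qed

lemma length_disj_sum: "length (tuple (G \<oplus> H)) = length (tuple G)"
  by (subst disj_sum.simps) simp

lemma fimage_ident_on: "(\<And>x. x |\<in>| A \<Longrightarrow> f x = x) \<Longrightarrow> f |`| A = A"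
  by force

text \<open>Zero contributes no options, and by induction adding it leaves every option of
  \<open>G\<close> unchanged. The result is an equality of games, so it can be used for
  rewriting.\<close>

lemma disj_sum_zero_right: "partizan N G \<Longrightarrow> G \<oplus> zero_game N = G"
proof (induction "size G" arbitrary: G rule: less_induct)
  case less
  note len = partizan_length[OF less.prems] partizan_length[OF partizan_zero_game]
  have "(\<lambda>G'. G' \<oplus> zero_game N) |`| opts G i = opts G i" for i
    by (intro fimage_ident_on less.hyps option_size_less partizan_opts[OF less.prems])
  then show ?case
    using len by (intro game_eqI[of _ N]) (simp_all add: length_disj_sum opts_disj_sum[OF len])
qed

lemma disj_sum_zero_left: "partizan N G \<Longrightarrow> zero_game N \<oplus> G = G"
proof (induction "size G" arbitrary: G rule: less_induct)
  case less
  note len = partizan_length[OF partizan_zero_game] partizan_length[OF less.prems]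
  have "(\<lambda>G'. zero_game N \<oplus> G') |`| opts G i = opts G i" for i
    by (intro fimage_ident_on less.hyps option_size_less partizan_opts[OF less.prems])
  then show ?case
    using len by (intro game_eqI[of _ N]) (simp_all add: length_disj_sum opts_disj_sum[OF len])
qed

(* Both disjuncts are needed in the induction: a move by Left in the other component exchanges
   the roles of G and X. *)
lemma not_wins_disj_sum:
  assumes "partizan N G" "partizan N X"
    and "\<not> wins_to_move N 0 G \<and> \<not> wins_to_move N p X \<or>
         \<not> wins_to_move N p G \<and> \<not> wins_to_move N 0 X"
  shows "\<not> wins_to_move N p (G \<oplus> X)"
  using assms
proof (induction "size G + size X" arbitrary: G X p rule: less_induct)
  case less
  note opts_sum = opts_disj_sum[OF less.prems(1,2)[THEN partizan_length]]
  \<comment> \<open>After a move in \<open>G\<close>, the second disjunct is the one to maintain: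
    \<open>X\<close> waits, lost for Left whenever Left is to move there.\<close>
  have IH_G: "\<not> wins_to_move N q (g \<oplus> X)"
    if "g |\<in>| opts G i" "\<not> wins_to_move N q g" "\<not> wins_to_move N 0 X" for g i q
    using that less.prems(2) option_size_less[OF that(1)] partizan_opts[OF less.prems(1) that(1)]
    by (intro less.hyps) auto
  have IH_X: "\<not> wins_to_move N q (G \<oplus> x)"
    if "x |\<in>| opts X i" "\<not> wins_to_move N q x" "\<not> wins_to_move N 0 G" for x i q
    using that less.prems(1) option_size_less[OF that(1)] partizan_opts[OF less.prems(2) that(1)]
    by (intro less.hyps) auto
  show ?case
  proof (cases "p = 0")
    case True
    then have lost: "\<not> wins_to_move N 0 G" "\<not> wins_to_move N 0 X"
      using less.prems(3) by auto
    \<comment> \<open>For \<open>p = 0\<close> both disjuncts say the same. Any move by Left leads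
      to a lost position in its component, while the other component still waits for Left.\<close>
    then have "\<not> wins_to_move N (Suc 0 mod N) g" if "g |\<in>| opts G 0 \<or> g |\<in>| opts X 0" for g
      using that by (auto simp: wins_to_move_0_iff)
    with lost show ?thesis
      using IH_G IH_X unfolding True wins_to_move_0_iff[of N "G \<oplus> X"] opts_sum by auto
  next
    case False
    \<comment> \<open>The coalition moves in the component that is lost for Left with
      \<open>p\<close> to move. A refuting option exists there, so \<open>p\<close> is not stuck in
      the sum.\<close>
    have "\<exists>y. y |\<in>| opts (G \<oplus> X) p \<and> \<not> wins_to_move N (Suc p mod N) y"
      using less.prems(3)
    proof (elim disjE conjE)
      assume "\<not> wins_to_move N 0 G" "\<not> wins_to_move N p X"
      moreover from this(2) obtain x where "x |\<in>| opts X p" "\<not> wins_to_move N (Suc p mod N) x"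
        using False by (auto simp: wins_to_move_other_iff)
      ultimately show ?thesis
        using IH_X by (intro exI[of _ "G \<oplus> x"]) (auto simp: opts_sum)
    next
      assume "\<not> wins_to_move N p G" "\<not> wins_to_move N 0 X"
      moreover from this(1) obtain g where "g |\<in>| opts G p" "\<not> wins_to_move N (Suc p mod N) g"
        using False by (auto simp: wins_to_move_other_iff)
      ultimately show ?thesis
        using IH_G by (intro exI[of _ "g \<oplus> X"]) (auto simp: opts_sum)
    qed
    then show ?thesis
      using False by (auto simp: wins_to_move_other_iff)
  qed
qed

theorem mainTheorem13:
  fixes N :: nat and G :: game
  assumes "N \<ge> 2" and "partizan N G"
  shows "le_left N G (zero_game N) \<longleftrightarrow> \<not> left_wins_moving N 1 G"
proof
  assume "le_left N G (zero_game N)"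
  \<comment> \<open>Test the order with zero as \<open>X\<close> and with Left moving first: Left
    loses at once in zero.\<close>
  then have "left_wins_moving N 1 (G \<oplus> zero_game N)
      \<Longrightarrow> left_wins_moving N 1 (zero_game N \<oplus> zero_game N)"
    using assms(1) partizan_zero_game by (auto simp: le_left_def)
  moreover have "\<not> left_wins_moving N 1 (zero_game N)"
    by (simp add: left_wins_moving_iff wins_to_move_0_iff)
  ultimately show "\<not> left_wins_moving N 1 G"
    using assms(2) by (auto simp: disj_sum_zero_right partizan_zero_game)
next
  assume "\<not> left_wins_moving N 1 G"
  then have "\<not> wins_to_move N 0 G"
    by (simp add: left_wins_moving_iff)
  \<comment> \<open>By contraposition: if Left loses \<open>X\<close> with \<open>p\<close> to move,
    then Left also loses \<open>G \<oplus> X\<close>, by the first disjunct; and adding zero to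
    \<open>X\<close> gives \<open>X\<close> itself.\<close>
  then show "le_left N G (zero_game N)"
    using not_wins_disj_sum[OF assms(2)]
    by (auto simp: le_left_def left_wins_moving_iff disj_sum_zero_left)
qed

end
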